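(* Let $N\ge2$ and let $(S_i)_{i\in\mathbb{Z}_N}$ be a purely atomic representation of the Cuntz algebra $\mathcal{O}_N$. If the representation is supported on an aperiodic set, then the representation is permutative. Moreover the representation can be decomposed into a direct sum of permutative representations with injective coding map.
   Context: $\mathbb{Z}_N=\{0,1,\dots,N-1\}$. A representation of the Cuntz algebra $\mathcal{O}_N$ on a Hilbert space $\mathcal{H}$ is a family $(S_i)_{i\in\mathbb{Z}_N}$ of bounded operators on $\mathcal{H}$ with $S_i^*S_j=\delta_{ij}I$ for all $i,j$ and $\sum_{i\in\mathbb{Z}_N}S_iS_i^*=I$. For a finite word $I=i_1\dots i_n$, $S_I:=S_{i_1}\cdots S_{i_n}$. $\mathcal{K}_N=\mathbb{Z}_N^{\mathbb{N}}$ is the space of infinite words with the product topology and $\sigma(\omega_1\omega_2\dots)=\omega_2\omega_3\dots$ is the shift. The projection valued measure $P$ associated to the representation is the unique projection valued measure on the Borel sets of $\mathcal{K}_N$ with $P(\{\omega:\omega_1=i_1,\dots,\omega_k=i_k\})=S_IS_I^*$ for every finite word $I=i_1\dots i_k$. Write $P(\omega)=P(\{\omega\})$. The representation is purely atomic and supported on $\Omega\subset\mathcal{K}_N$ if $\oplus_{\omega\in\Omega}P(\omega)=I$. A word $\omega\in\mathcal{K}_N$ is periodic if $\sigma^k(\omega)=\sigma^{k'}(\omega)$ for some non-negative integers $k\neq k'$. A subset of $\mathcal{K}_N$ is aperiodic if it contains no periodic points. A representation is permutative if there is an orthonormal basis $\{e_\lambda:\lambda\in\Lambda\}$ of $\mathcal{H}$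 such that for all $\lambda\in\Lambda$, $j\in\mathbb{Z}_N$, $S_je_\lambda$ is an element of this basis; write $S_je_\lambda=e_{\sigma_j(\lambda)}$. The maps $\sigma_j:\Lambda\to\Lambda$ are injective with disjoint ranges whose union is $\Lambda$; let $\sigma:\Lambda\to\Lambda$ be the map with $\sigma(\sigma_j(\lambda))=\lambda$ for all $j,\lambda$. The coding map is $E:\Lambda\to\mathcal{K}_N$, $E(\lambda)=j_0j_1j_2\dots$, where $\sigma^k(\lambda)\in\sigma_{j_k}(\Lambda)$ for all $k\ge0$. *)

theory Defs
  imports "HOL-Analysis.Analysis"
begin

text \<open>Complex Hilbert spaces, with the inner product linear in the first argument.
  Positive definiteness and the triangle inequality are part of \<open>banach\<close> together with
  \<open>cinner_self\<close>; the last \<open>scaleC\<close> axiom makes the real structure of the normed space the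
  restriction of the complex one.\<close>

class complex_hilbert_space = banach +
  fixes scaleC :: "complex \<Rightarrow> 'a \<Rightarrow> 'a"
    and cinner :: "'a \<Rightarrow> 'a \<Rightarrow> complex"
  assumes scaleC_add_right: "scaleC c (x + y) = scaleC c x + scaleC c y"
    and scaleC_add_left: "scaleC (c + d) x = scaleC c x + scaleC d x"
    and scaleC_scaleC: "scaleC c (scaleC d x) = scaleC (c * d) x"
    and scaleC_of_real: "scaleC (complex_of_real r) x = scaleR r x"
    and cinner_commute: "cinner x y = cnj (cinner y x)"
    and cinner_add_left: "cinner (x + y) z = cinner x z + cinner y z"
    and cinner_scaleC_left: "cinner (scaleC c x) y = c * cinner x y"
    and cinner_self: "cinner x x = complex_of_real ((norm x)\<^sup>2)"

global_interpretation complex_vector: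
  vector_space "scaleC :: complex \<Rightarrow> 'a \<Rightarrow> 'a::complex_hilbert_space"
proof
  fix x :: 'a
  show "scaleC 1 x = x"
    using scaleC_of_real[of 1 x] by simp
qed (simp_all add: scaleC_add_right scaleC_add_left scaleC_scaleC)

text \<open>Sub-Hilbert spaces are closed complex subspaces \<open>H\<close> of a type of class
  \<open>complex_hilbert_space\<close>. Operators on \<open>H\<close> are functions on the whole type of which only
  the values on \<open>H\<close> matter, so an operator and its restriction to an invariant subspace are
  the same function.\<close>

definition closed_csubspace :: "'a::complex_hilbert_space set \<Rightarrow> bool" where
  "closed_csubspace H \<longleftrightarrow> complex_vector.subspace H \<and> closed H"

definition bounded_operator_on :: "'a::complex_hilbert_space set \<Rightarrow> ('a \<Rightarrow> 'a) \<Rightarrow> bool" where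
  "bounded_operator_on H T \<longleftrightarrow>
     T ` H \<subseteq> H \<and>
     (\<forall>x\<in>H. \<forall>y\<in>H. T (x + y) = T x + T y) \<and>
     (\<forall>c. \<forall>x\<in>H. T (scaleC c x) = scaleC c (T x)) \<and>
     (\<exists>K. \<forall>x\<in>H. norm (T x) \<le> K * norm x)"

definition adjoint_on :: "'a::complex_hilbert_space set \<Rightarrow> ('a \<Rightarrow> 'a) \<Rightarrow> 'a \<Rightarrow> 'a" where
  "adjoint_on H T y = (THE z. z \<in> H \<and> (\<forall>x\<in>H. cinner (T x) y = cinner x z))"

definition orthogonal_projection_on :: "'a::complex_hilbert_space set \<Rightarrow> ('a \<Rightarrow> 'a) \<Rightarrow> bool" where
  "orthogonal_projection_on H Q \<longleftrightarrow>
     bounded_operator_on H Q \<and>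
     (\<forall>x\<in>H. Q (Q x) = Q x) \<and>
     (\<forall>x\<in>H. \<forall>y\<in>H. cinner (Q x) y = cinner x (Q y))"

definition orthonormal_basis_of :: "'a::complex_hilbert_space set \<Rightarrow> 'a set \<Rightarrow> bool" where
  "orthonormal_basis_of H B \<longleftrightarrow>
     (\<forall>e\<in>B. \<forall>f\<in>B. cinner e f = (if e = f then 1 else 0)) \<and>
     closure (complex_vector.span B) = H"

definition orthogonal_direct_sum ::
    "'a::complex_hilbert_space set \<Rightarrow> 'a set set \<Rightarrow> bool" where
  "orthogonal_direct_sum H \<M> \<longleftrightarrow>
     (\<forall>M\<in>\<M>. closed_csubspace M) \<and>
     (\<forall>M\<in>\<M>. \<forall>M'\<in>\<M>. M \<noteq> M' \<longrightarrow> (\<forall>x\<in>M. \<forall>y\<in>M'. cinner x y = 0)) \<and>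
     closure (complex_vector.span (\<Union>\<M>)) = H"

definition cuntz_rep :: "nat \<Rightarrow> 'a::complex_hilbert_space set \<Rightarrow> (nat \<Rightarrow> 'a \<Rightarrow> 'a) \<Rightarrow> bool" where
  "cuntz_rep N H S \<longleftrightarrow>
     closed_csubspace H \<and>
     (\<forall>i<N. bounded_operator_on H (S i)) \<and>
     (\<forall>i<N. \<forall>j<N. \<forall>x\<in>H. adjoint_on H (S i) (S j x) = (if i = j then x else 0)) \<and>
     (\<forall>x\<in>H. (\<Sum>i<N. S i (adjoint_on H (S i) x)) = x)"

primrec word_op :: "(nat \<Rightarrow> 'a \<Rightarrow> 'a) \<Rightarrow> nat list \<Rightarrow> 'a \<Rightarrow> 'a" where
  "word_op S [] = id"
| "word_op S (i # I) = S i \<circ> word_op S I"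

text \<open>Infinite words are indexed from \<open>0\<close>.\<close>

definition infinite_words :: "nat \<Rightarrow> (nat \<Rightarrow> nat) set" where
  "infinite_words N = {\<omega>. \<forall>n. \<omega> n < N}"

text \<open>The type \<open>nat \<Rightarrow> nat\<close> carries the product of the discrete topologies, and its subspace
  topology on \<open>infinite_words N\<close> is the product topology there.\<close>

definition words_borel :: "nat \<Rightarrow> (nat \<Rightarrow> nat) measure" where
  "words_borel N = restrict_space borel (infinite_words N)"

definition cylinder :: "nat \<Rightarrow> nat list \<Rightarrow> (nat \<Rightarrow> nat) set" where
  "cylinder N I = {\<omega> \<in> infinite_words N. \<forall>k<length I. \<omega> k = I ! k}"

definition word_shift :: "(nat \<Rightarrow> nat) \<Rightarrow> nat \<Rightarrow> nat" where
  "word_shift \<omega> = (\<lambda>n. \<omega> (Suc n))"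

definition periodic_word :: "(nat \<Rightarrow> nat) \<Rightarrow> bool" where
  "periodic_word \<omega> \<longleftrightarrow> (\<exists>k k'. k \<noteq> k' \<and> (word_shift ^^ k) \<omega> = (word_shift ^^ k') \<omega>)"

definition aperiodic_set :: "(nat \<Rightarrow> nat) set \<Rightarrow> bool" where
  "aperiodic_set \<Omega> \<longleftrightarrow> (\<forall>\<omega>\<in>\<Omega>. \<not> periodic_word \<omega>)"

definition projection_valued_measure ::
    "'a::complex_hilbert_space set \<Rightarrow> 'b measure \<Rightarrow> ('b set \<Rightarrow> 'a \<Rightarrow> 'a) \<Rightarrow> bool" where
  "projection_valued_measure H X P \<longleftrightarrow>
     (\<forall>A\<in>sets X. orthogonal_projection_on H (P A)) \<and>
     (\<forall>x\<in>H. P (space X) x = x) \<and>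
     (\<forall>A\<in>sets X. \<forall>B\<in>sets X. \<forall>x\<in>H. P (A \<inter> B) x = P A (P B x)) \<and>
     (\<forall>A :: nat \<Rightarrow> 'b set. range A \<subseteq> sets X \<longrightarrow> disjoint_family A \<longrightarrow>
        (\<forall>x\<in>H. (\<lambda>n. P (A n) x) sums P (\<Union>n. A n) x))"

text \<open>\<open>P\<close> is the projection valued measure associated with the representation \<open>S\<close>; on the
  Borel sets it is determined by \<open>S\<close>.\<close>

definition associated_pvm :: "nat \<Rightarrow> 'a::complex_hilbert_space set \<Rightarrow> (nat \<Rightarrow> 'a \<Rightarrow> 'a) \<Rightarrow>
    ((nat \<Rightarrow> nat) set \<Rightarrow> 'a \<Rightarrow> 'a) \<Rightarrow> bool" where
  "associated_pvm N H S P \<longleftrightarrow>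
     projection_valued_measure H (words_borel N) P \<and>
     (\<forall>I. set I \<subseteq> {..<N} \<longrightarrow>
        (\<forall>x\<in>H. P (cylinder N I) x = word_op S I (adjoint_on H (word_op S I) x)))"

text \<open>The sum of the mutually orthogonal projections \<open>P {\<omega>}\<close> converges strongly to the
  identity; \<open>\<Omega>\<close> may be uncountable.\<close>

definition purely_atomic_supported_on :: "nat \<Rightarrow> 'a::complex_hilbert_space set \<Rightarrow>
    ((nat \<Rightarrow> nat) set \<Rightarrow> 'a \<Rightarrow> 'a) \<Rightarrow> (nat \<Rightarrow> nat) set \<Rightarrow> bool" where
  "purely_atomic_supported_on N H P \<Omega> \<longleftrightarrow>
     \<Omega> \<subseteq> infinite_words N \<and> (\<forall>x\<in>H. ((\<lambda>\<omega>. P {\<omega>} x) has_sum x) \<Omega>)"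

text \<open>An orthonormal basis is given as a set \<open>B\<close> of vectors, which serves as its own index
  set, so that the maps \<open>\<sigma>\<^sub>j\<close> on the index set are the restrictions of \<open>S j\<close> to \<open>B\<close>.\<close>

definition permutative_basis :: "nat \<Rightarrow> 'a::complex_hilbert_space set \<Rightarrow>
    (nat \<Rightarrow> 'a \<Rightarrow> 'a) \<Rightarrow> 'a set \<Rightarrow> bool" where
  "permutative_basis N H S B \<longleftrightarrow>
     orthonormal_basis_of H B \<and> (\<forall>j<N. \<forall>e\<in>B. S j e \<in> B)"

definition permutative :: "nat \<Rightarrow> 'a::complex_hilbert_space set \<Rightarrow> (nat \<Rightarrow> 'a \<Rightarrow> 'a) \<Rightarrow> bool" where
  "permutative N H S \<longleftrightarrow> cuntz_rep N H S \<and> (\<exists>B. permutative_basis N H S B)"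

definition basis_shift :: "nat \<Rightarrow> (nat \<Rightarrow> 'a \<Rightarrow> 'a) \<Rightarrow> 'a set \<Rightarrow> 'a \<Rightarrow> 'a" where
  "basis_shift N S B e = (THE f. f \<in> B \<and> (\<exists>j<N. S j f = e))"

definition coding_map :: "nat \<Rightarrow> (nat \<Rightarrow> 'a \<Rightarrow> 'a) \<Rightarrow> 'a set \<Rightarrow> 'a \<Rightarrow> nat \<Rightarrow> nat" where
  "coding_map N S B e = (\<lambda>k. THE j. j < N \<and> (basis_shift N S B ^^ k) e \<in> S j ` B)"

definition permutative_injective :: "nat \<Rightarrow> 'a::complex_hilbert_space set \<Rightarrow>
    (nat \<Rightarrow> 'a \<Rightarrow> 'a) \<Rightarrow> bool" where
  "permutative_injective N H S \<longleftrightarrow>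
     cuntz_rep N H S \<and> (\<exists>B. permutative_basis N H S B \<and> inj_on (coding_map N S B) B)"

end

theory Submission
  imports Defs
begin

text \<open>
  Let \<open>T\<close> be the sum of the adjoints of the operators \<open>S j\<close>, so that \<open>T (S j x) = x\<close> for
  all \<open>j\<close>. The range of the projection \<open>P {\<omega>}\<close> lies in the \<^emph>\<open>atom\<close> of \<open>\<omega>\<close>: the vectors \<open>x\<close>
  such that each \<open>T\<^sup>k x\<close> is in the range of \<open>S (\<omega> k)\<close>. The operator \<open>T\<close> maps the atom
  of \<open>\<omega>\<close> isometrically onto the atom of the shifted word, with inverse \<open>S (\<omega> 0)\<close>; atoms of
  different words are orthogonal (\<open>atoms_orthogonal\<close>); and since the representation is purely
  atomic, the atoms span the whole space and only words in \<open>\<Omega>\<close> have nonzero atoms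
  (\<open>atom_in_support\<close>).

  Take a unit vector \<open>e\<close> in an atom, and let its orbit consist of the unit vectors \<open>x\<close> in atoms
  with \<open>T\<^sup>m x = T\<^sup>n e\<close> for some \<open>m\<close> and \<open>n\<close>. It is closed under every \<open>S j\<close> and, up to zero,
  under the adjoints. Two vectors of the orbit in the same atom are equal: shifting both of them \<open>k\<close>
  times, for a large \<open>k\<close>, gives two iterates \<open>T\<^sup>n e\<close> and \<open>T\<^sup>q e\<close> in a common atom, so the word of
  \<open>e\<close> shifted \<open>n\<close> times coincides with the same word shifted \<open>q\<close> times, and aperiodicity gives
  \<open>n = q\<close> (\<open>same_orbit_same_atom\<close>). Hence the orbit is orthonormal, and it is a permutative basis of
  its closed span. The coding map sends a vector in the atom of \<open>\<omega>\<close> to \<open>\<omega>\<close>, so it is injective on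
  the orbit.

  It remains to fill the space with pairwise orthogonal orbits. By Zorn's lemma there is a maximal
  orthonormal union \<open>B\<close> of orbits. If some nonzero vector were orthogonal to \<open>B\<close>, then one of its
  components \<open>P {\<omega>} x\<close> would be nonzero and orthogonal to \<open>B\<close>, and so would be the whole orbit of the
  normalized component, contradicting maximality (\<open>orbit_system_spanning\<close>). Thus \<open>B\<close> is a
  permutative basis of the whole space, and the closed spans of its orbits give the decomposition.

  Completeness is needed twice: for a vector orthogonal to a proper closed subspace, and, through the
  Riesz representation theorem derived from it, for the existence of adjoints.
\<close>

section \<open>Complex Hilbert spaces\<close>

lemma cinner_add_right: "cinner x (y + z) = cinner x y + cinner x z"
  by (metis cinner_add_left cinner_commute complex_cnj_add)

lemma cinner_scaleC_right: "cinner x (scaleC c y) = cnj c * cinner x y"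
  by (metis cinner_commute cinner_scaleC_left complex_cnj_mult)

lemma cinner_zero_left [simp]: "cinner 0 x = 0"
  using cinner_add_left[of 0 0 x] by simp

lemma cinner_zero_right [simp]: "cinner x 0 = 0"
  using cinner_add_right[of x 0 0] by simp

lemma cinner_diff_left: "cinner (x - y) z = cinner x z - cinner y z"
  using cinner_add_left[of "x - y" y z] by simp

lemma cinner_diff_right: "cinner x (y - z) = cinner x y - cinner x z"
  using cinner_add_right[of x "y - z" z] by simp

lemma cinner_sum_left: "cinner (\<Sum>i\<in>I. f i) y = (\<Sum>i\<in>I. cinner (f i) y)"
  by (induction I rule: infinite_finite_induct) (simp_all add: cinner_add_left)

lemma cinner_eq_zero_commute: "cinner x y = 0 \<longleftrightarrow> cinner y x = 0"
  by (metis cinner_commute complex_cnj_zero_iff)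

lemma cinner_self_eq_zero [simp]: "cinner x x = 0 \<longleftrightarrow> x = 0"
  by (simp add: cinner_self)

lemma cinner_ext:
  assumes "\<And>x. cinner x y = cinner x z"
  shows "y = z"
  using assms[of "y - z"] by (metis cinner_diff_right cinner_self_eq_zero right_minus_eq)

lemma norm_add_squared: "(norm (x + y))\<^sup>2 = (norm x)\<^sup>2 + (norm y)\<^sup>2 + 2 * Re (cinner x y)"
proof -
  have "complex_of_real ((norm (x + y))\<^sup>2) =
    complex_of_real ((norm x)\<^sup>2) + complex_of_real ((norm y)\<^sup>2) + (cinner x y + cnj (cinner x y))"
    by (simp only: cinner_self[symmetric] cinner_add_left cinner_add_right cinner_commute[of y x])
      (simp add: algebra_simps)
  also have "\<dots> = complex_of_real ((norm x)\<^sup>2 + (norm y)\<^sup>2 + 2 * Re (cinner x y))"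
    by (simp add: complex_add_cnj)
  finally show ?thesis
    by (simp only: of_real_eq_iff)
qed

lemma norm_diff_squared: "(norm (x - y))\<^sup>2 = (norm x)\<^sup>2 + (norm y)\<^sup>2 - 2 * Re (cinner x y)"
  using norm_add_squared[of "x - y" y] by (simp add: cinner_diff_left cinner_self)

lemma parallelogram_law:
  "(norm (x + y))\<^sup>2 + (norm (x - y))\<^sup>2 = 2 * (norm x)\<^sup>2 + 2 * (norm (y :: 'a::complex_hilbert_space))\<^sup>2"
  by (simp add: norm_add_squared norm_diff_squared)

lemma norm_scaleC: "norm (scaleC c x) = cmod c * norm x"
proof -
  have "complex_of_real ((norm (scaleC c x))\<^sup>2) = (c * cnj c) * complex_of_real ((norm x)\<^sup>2)"
    by (simp only: cinner_self[symmetric] cinner_scaleC_left cinner_scaleC_right mult_ac)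
  also have "\<dots> = complex_of_real ((cmod c * norm x)\<^sup>2)"
    by (simp add: power_mult_distrib flip: complex_norm_square)
  finally show ?thesis
    by (simp only: of_real_eq_iff) (simp add: power2_eq_iff_nonneg)
qed

text \<open>By polarization the inner product is a combination of squared norms.\<close>

lemma continuous_on_cinner_left: "continuous_on UNIV (\<lambda>x. cinner x y)"
proof -
  have "cinner x y = Complex (((norm x)\<^sup>2 + (norm y)\<^sup>2 - (norm (x - y))\<^sup>2) / 2)
      (((norm x)\<^sup>2 + (norm (scaleC \<i> y))\<^sup>2 - (norm (x - scaleC \<i> y))\<^sup>2) / 2)" for x
    by (simp add: complex_eq_iff norm_diff_squared cinner_scaleC_right)
  then show ?thesis
    by (simp add: Complex_eq) (intro continuous_intros; simp)
qed

lemma bounded_operator_continuous: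
  assumes "bounded_operator_on UNIV T"
  shows "continuous_on UNIV T"
proof -
  have "bounded_linear T"
  proof -
    obtain K where "\<And>x. norm (T x) \<le> K * norm x"
      using assms unfolding bounded_operator_on_def by auto
    then show ?thesis
      using assms unfolding bounded_operator_on_def
      by (intro bounded_linear_intro[where K = K])
        (auto simp: mult.commute simp flip: scaleC_of_real)
  qed
  then show ?thesis
    by (rule linear_continuous_on)
qed

lemma continuous_map_closure_image:
  assumes "continuous_on UNIV T" "T ` X \<subseteq> Y" "closed Y"
  shows "T ` closure X \<subseteq> Y"
  using assms by (metis closure_minimal closed_vimage image_subset_iff_subset_vimage)

lemma csubspace_closure:
  assumes "complex_vector.subspace M"
  shows "complex_vector.subspace (closure M)"
proof (rule complex_vector.subspaceI)
  show "0 \<in> closure M"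
    using assms closure_subset complex_vector.subspace_0 by blast
next
  fix x y assume "x \<in> closure M" "y \<in> closure M"
  then obtain f g where f: "\<And>n. f n \<in> M" "f \<longlonglongrightarrow> x" and g: "\<And>n. g n \<in> M" "g \<longlonglongrightarrow> y"
    unfolding closure_sequential by auto
  have "(\<lambda>n. f n + g n) \<longlonglongrightarrow> x + y"
    by (intro tendsto_intros f g)
  moreover have "f n + g n \<in> M" for n
    using f g assms complex_vector.subspace_add by blast
  ultimately show "x + y \<in> closure M"
    unfolding closure_sequential by (intro exI[of _ "\<lambda>n. f n + g n"]) auto
next
  fix c x assume x: "x \<in> closure M"
  have "continuous_on UNIV (scaleC c :: 'a \<Rightarrow> 'a)"
    by (rule bounded_operator_continuous)
      (auto simp: bounded_operator_on_def scaleC_add_right scaleC_scaleC norm_scaleC mult.commute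
        intro!: exI[of _ "cmod c"])
  moreover have "scaleC c ` M \<subseteq> closure M"
    using assms closure_subset complex_vector.subspace_scale by blast
  ultimately show "scaleC c x \<in> closure M"
    using x continuous_map_closure_image[of "scaleC c"] by blast
qed

lemma closed_csubspace_closure_span: "closed_csubspace (closure (complex_vector.span X))"
  by (simp add: closed_csubspace_def csubspace_closure)

lemma closed_csubspace_minimal:
  assumes "closed_csubspace M" "X \<subseteq> M"
  shows "closure (complex_vector.span X) \<subseteq> M"
  using assms by (simp add: closed_csubspace_def closure_minimal complex_vector.span_minimal)

lemma subset_closure_span: "X \<subseteq> closure (complex_vector.span X)"
  using closure_subset complex_vector.span_superset by blast

lemma bounded_operator_closure_span:
  assumes T: "bounded_operator_on UNIV T" and M: "closed_csubspace M" and "T ` B \<subseteq> M"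
  shows "T ` closure (complex_vector.span B) \<subseteq> M"
proof -
  have lin: "T (u + v) = T u + T v" "T (scaleC c u) = scaleC c (T u)" for u v c
    using T by (auto simp: bounded_operator_on_def)
  have "T 0 = 0"
    using lin(1)[of 0 0] by simp
  have closedM: "closed M" and subM: "complex_vector.subspace M"
    using M by (auto simp: closed_csubspace_def)
  have "complex_vector.subspace {u. T u \<in> M}"
    using subM by (intro complex_vector.subspaceI)
      (auto simp: lin \<open>T 0 = 0\<close> complex_vector.subspace_0 complex_vector.subspace_add
        complex_vector.subspace_scale)
  then have "T ` complex_vector.span B \<subseteq> M"
    using assms(3) complex_vector.span_minimal[of B "{u. T u \<in> M}"] by blast
  then show ?thesis
    using bounded_operator_continuous[OF T] closedM by (intro continuous_map_closure_image)
qed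

lemma closed_csubspace_kernel:
  fixes f :: "'a::complex_hilbert_space \<Rightarrow> complex"
  assumes "continuous_on UNIV f" "\<And>x y. f (x + y) = f x + f y" "\<And>c x. f (scaleC c x) = c * f x"
  shows "closed_csubspace {x. f x = 0}"
proof -
  have "closed (f -` {0})"
    using assms(1) by (simp add: closed_vimage)
  moreover have "f 0 = 0"
    using assms(2)[of 0 0] by simp
  ultimately show ?thesis
    by (auto simp: closed_csubspace_def complex_vector.subspace_def assms vimage_def)
qed

lemma closed_csubspace_orthogonal: "closed_csubspace {x. cinner x y = 0}"
  by (rule closed_csubspace_kernel)
    (simp_all add: continuous_on_cinner_left cinner_add_left cinner_scaleC_left)

lemma closure_span_orthogonal:
  assumes "\<And>x y. x \<in> X \<Longrightarrow> y \<in> Y \<Longrightarrow> cinner x y = 0"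
    and "x \<in> closure (complex_vector.span X)" "y \<in> closure (complex_vector.span Y)"
  shows "cinner x y = 0"
proof -
  have "cinner x y' = 0" if "y' \<in> Y" for y'
    using closed_csubspace_minimal[OF closed_csubspace_orthogonal[of y']] assms(1,2) that by blast
  then show ?thesis
    using closed_csubspace_minimal[OF closed_csubspace_orthogonal[of x], of Y] assms(3)
    by (auto simp: cinner_eq_zero_commute[of _ x])
qed

text \<open>The points of \<open>M\<close> that are nearly closest to \<open>x\<close> form nested sets whose diameters tend to
  \<open>0\<close> by the parallelogram law, so completeness gives a closest one.\<close>

lemma closest_point_in_subspace:
  assumes M: "closed_csubspace M"
  obtains a where "a \<in> M" "\<And>u. u \<in> M \<Longrightarrow> norm (x - a) \<le> norm (x - u)"
proof -
  define d where "d = infdist x M"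
  define F where "F n = M \<inter> cball x (d + inverse (Suc n))" for n
  have sub: "complex_vector.subspace M" and "closed M"
    using M by (auto simp: closed_csubspace_def)
  have "0 \<in> M"
    using sub complex_vector.subspace_0 by blast
  then have "M \<noteq> {}"
    by blast
  have d: "d \<le> norm (x - u)" if "u \<in> M" for u
    using that infdist_le[of u M x] by (simp add: d_def dist_norm)
  have "d \<ge> 0"
    by (simp add: d_def infdist_nonneg)
  obtain a where a: "\<And>n. a \<in> F n"
  proof (rule decreasing_closed_nest[of F])
    show "closed (F n)" for n
      by (simp add: F_def \<open>closed M\<close> closed_Int)
    show "F n \<noteq> {}" for n
    proof -
      have "(INF u\<in>M. dist x u) < d + inverse (Suc n)"
        using infdist_notempty[OF \<open>M \<noteq> {}\<close>, of x] by (simp add: d_def del: of_nat_Suc)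
      then obtain u where "u \<in> M" "dist x u < d + inverse (Suc n)"
        using \<open>M \<noteq> {}\<close> by (subst (asm) cINF_less_iff) (auto intro: bdd_belowI2[of _ 0])
      then show ?thesis
        by (auto simp: F_def intro!: exI[of _ u])
    qed
    show "F n \<subseteq> F m" if "m \<le> n" for m n
    proof -
      have "inverse (real (Suc n)) \<le> inverse (real (Suc m))"
        using that by (intro le_imp_inverse_le) auto
      then show ?thesis
        unfolding F_def by (intro Int_mono subset_cball add_left_mono order_refl)
    qed
    show "\<exists>n. \<forall>u\<in>F n. \<forall>v\<in>F n. dist u v < e" if "e > 0" for e
    proof -
      obtain n where n: "inverse (real (Suc n)) < e\<^sup>2 / (8 * d + 4)"
        using reals_Archimedean[of "e\<^sup>2 / (8 * d + 4)"] \<open>d \<ge> 0\<close> \<open>e > 0\<close> by auto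
      define \<delta> where "\<delta> = inverse (real (Suc n))"
      have \<delta>: "0 < \<delta>" "\<delta> \<le> 1" "(8 * d + 4) * \<delta> < e\<^sup>2"
        using n \<open>d \<ge> 0\<close> by (auto simp: \<delta>_def field_simps)
      have "dist u v < e" if "u \<in> F n" "v \<in> F n" for u v
      proof -
        have uv: "u \<in> M" "v \<in> M" "norm (x - u) \<le> d + \<delta>" "norm (x - v) \<le> d + \<delta>"
          using that by (auto simp: F_def \<delta>_def dist_norm)
        define w where "w = scaleC (1/2) (u + v)"
        have "w \<in> M"
          using uv sub complex_vector.subspace_add complex_vector.subspace_scale
          unfolding w_def by blast
        have "w = (1/2) *\<^sub>R (u + v)"
          unfolding w_def using scaleC_of_real[of "1/2" "u + v"] by simp
        then have "(x - u) + (x - v) = 2 *\<^sub>R (x - w)"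
          by (simp add: algebra_simps scaleR_2)
        then have "norm ((x - u) + (x - v)) = 2 * norm (x - w)"
          by simp
        then have "2 * d \<le> norm ((x - u) + (x - v))"
          using d[OF \<open>w \<in> M\<close>] by simp
        then have "(2 * d)\<^sup>2 \<le> (norm ((x - u) + (x - v)))\<^sup>2"
          using \<open>d \<ge> 0\<close> by (intro power_mono) auto
        moreover have "(norm (x - u))\<^sup>2 \<le> (d + \<delta>)\<^sup>2" "(norm (x - v))\<^sup>2 \<le> (d + \<delta>)\<^sup>2"
          using uv by (auto intro!: power_mono)
        moreover have "norm ((x - u) - (x - v)) = dist u v"
          by (simp add: dist_norm norm_minus_commute)
        ultimately have "(dist u v)\<^sup>2 \<le> 4 * (d + \<delta>)\<^sup>2 - (2 * d)\<^sup>2"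
          using parallelogram_law[of "x - u" "x - v"] by simp
        also have "\<dots> = (8 * d + 4 * \<delta>) * \<delta>"
          by (simp add: power2_eq_square algebra_simps)
        also have "\<dots> \<le> (8 * d + 4) * \<delta>"
          using \<delta> by (intro mult_right_mono) auto
        also have "\<dots> < e\<^sup>2"
          by (rule \<delta>)
        finally show ?thesis
          using \<open>e > 0\<close> by (simp add: power_less_imp_less_base)
      qed
      then show ?thesis by blast
    qed
  qed blast
  have "norm (x - a) \<le> d"
  proof (rule field_le_epsilon)
    fix e :: real assume "e > 0"
    then obtain n where "inverse (real (Suc n)) < e"
      using reals_Archimedean by blast
    then show "norm (x - a) \<le> d + e"
      using a[of n] by (auto simp: F_def dist_norm)
  qed
  then show ?thesis
    using that[of a] a[of 0] d by (force simp: F_def)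
qed

text \<open>The vector from the closest point of \<open>M\<close> to a point outside \<open>M\<close> is orthogonal to \<open>M\<close>.\<close>

lemma orthogonal_vector_exists:
  assumes M: "closed_csubspace M" "M \<noteq> UNIV"
  obtains y where "y \<noteq> 0" "\<And>v. v \<in> M \<Longrightarrow> cinner v y = 0"
proof -
  obtain x where "x \<notin> M"
    using M by blast
  obtain a where a: "a \<in> M" "\<And>u. u \<in> M \<Longrightarrow> norm (x - a) \<le> norm (x - u)"
    using closest_point_in_subspace[OF M(1)] by blast
  have sub: "complex_vector.subspace M"
    using M by (auto simp: closed_csubspace_def)
  have "cinner v (x - a) = 0" if "v \<in> M" for v
  proof (rule ccontr)
    define c where "c = cinner (x - a) v"
    define t where "t = inverse ((norm v)\<^sup>2 + 1)"
    assume "cinner v (x - a) \<noteq> 0"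
    then have "c \<noteq> 0"
      by (simp add: c_def cinner_eq_zero_commute[of "x - a"])
    have "t > 0" "t * (norm v)\<^sup>2 < 2"
      by (simp_all add: t_def field_simps add_pos_nonneg add_nonneg_pos)
    \<comment> \<open>A short enough step from \<open>a\<close> in the direction \<open>c v\<close> comes closer to \<open>x\<close>.\<close>
    define u where "u = scaleC (of_real t * c) v"
    have "a + u \<in> M"
      using sub a that complex_vector.subspace_add complex_vector.subspace_scale
      unfolding u_def by blast
    then have "(norm (x - a))\<^sup>2 \<le> (norm ((x - a) - u))\<^sup>2"
      using a by (simp add: power_mono algebra_simps)
    also have "\<dots> = (norm (x - a))\<^sup>2 + t * (cmod c)\<^sup>2 * (t * (norm v)\<^sup>2 - 2)"
    proof -
      have "cinner (x - a) u = of_real t * of_real ((cmod c)\<^sup>2)"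
        by (simp add: u_def cinner_scaleC_right flip: c_def)
          (simp add: complex_norm_square mult.commute flip: of_real_power)
      then have "Re (cinner (x - a) u) = t * (cmod c)\<^sup>2"
        by (simp flip: of_real_mult of_real_power)
      moreover have "norm u = t * cmod c * norm v"
        using \<open>t > 0\<close> by (simp add: u_def norm_scaleC norm_mult)
      ultimately show ?thesis
        unfolding norm_diff_squared[of "x - a" u] by (simp add: power2_eq_square algebra_simps)
    qed
    finally have "0 \<le> t * (cmod c)\<^sup>2 * (t * (norm v)\<^sup>2 - 2)"
      by simp
    moreover have "t * (cmod c)\<^sup>2 * (t * (norm v)\<^sup>2 - 2) < 0"
      using \<open>c \<noteq> 0\<close> \<open>t > 0\<close> \<open>t * (norm v)\<^sup>2 < 2\<close> by (intro mult_pos_neg) auto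
    ultimately show False
      by simp
  qed
  then show ?thesis
    using that[of "x - a"] \<open>x \<notin> M\<close> a by auto
qed

text \<open>Unless \<open>f = 0\<close>, there is a vector \<open>w\<close> orthogonal to the kernel of \<open>f\<close>; as
  \<open>f x w - f w x\<close> lies in the kernel for every \<open>x\<close>, a multiple of \<open>w\<close> represents \<open>f\<close>.\<close>

lemma riesz_representation:
  fixes f :: "'a::complex_hilbert_space \<Rightarrow> complex"
  assumes "continuous_on UNIV f" "\<And>x y. f (x + y) = f x + f y" "\<And>c x. f (scaleC c x) = c * f x"
  obtains z where "\<And>x. f x = cinner x z"
proof (cases "{x. f x = 0} = UNIV")
  case True
  then show ?thesis
    using that[of 0] by auto
next
  case False
  then obtain w where w: "w \<noteq> 0" "\<And>v. f v = 0 \<Longrightarrow> cinner v w = 0"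
    using orthogonal_vector_exists[OF closed_csubspace_kernel[OF assms]] by auto
  have f_diff: "f (x - y) = f x - f y" for x y
    using assms(2)[of "x - y" y] by simp
  have "f x = cinner x (scaleC (cnj (f w / cinner w w)) w)" for x
  proof -
    have "f (scaleC (f x) w - scaleC (f w) x) = 0"
      by (simp add: f_diff assms)
    from w(2)[OF this] show ?thesis
      using w(1) by (simp add: cinner_diff_left cinner_scaleC_left cinner_scaleC_right field_simps)
  qed
  then show ?thesis
    using that by blast
qed

lemma adjoint_on_eqI:
  assumes "z \<in> H" "\<And>x. x \<in> H \<Longrightarrow> cinner (T x) y = cinner x z"
  shows "adjoint_on H T y = z"
  unfolding adjoint_on_def
proof (rule the_equality)
  fix z' assume z': "z' \<in> H \<and> (\<forall>x\<in>H. cinner (T x) y = cinner x z')"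
  then have "cinner z' z' = cinner z' z" "cinner z z' = cinner z z"
    using assms by metis+
  then have "cinner (z' - z) (z' - z) = 0"
    by (simp add: cinner_diff_left cinner_diff_right)
  then show "z' = z"
    by simp
qed (use assms in blast)

text \<open>The description in \<^const>\<open>adjoint_on\<close> only means something once the vector described is known
  to exist; on the whole space the Riesz representation theorem provides it.\<close>

lemma adjoint_on_UNIV:
  assumes "bounded_operator_on UNIV T"
  shows "cinner (T x) y = cinner x (adjoint_on UNIV T y)"
proof -
  have "continuous_on UNIV (\<lambda>x. cinner (T x) y)"
    using continuous_on_compose2[OF continuous_on_cinner_left bounded_operator_continuous[OF assms]]
    by auto
  then obtain z where "\<And>x. cinner (T x) y = cinner x z"
    using riesz_representation[of "\<lambda>x. cinner (T x) y"] assms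
    by (auto simp: bounded_operator_on_def cinner_add_left cinner_scaleC_left)
  then show ?thesis
    using adjoint_on_eqI[of z UNIV T y] by simp
qed

section \<open>Words and their Borel sets\<close>

lemma word_shift_infinite_words: "\<omega> \<in> infinite_words N \<Longrightarrow> word_shift \<omega> \<in> infinite_words N"
  by (simp add: infinite_words_def word_shift_def)

lemma word_shift_funpow_nth: "(word_shift ^^ k) \<omega> n = \<omega> (n + k)"
  by (induction k arbitrary: n) (simp_all add: word_shift_def)

lemma word_op_append: "word_op S (I @ J) x = word_op S I (word_op S J x)"
  by (induction I) simp_all

lemma coordinate_set_borel: "{\<omega> :: nat \<Rightarrow> nat. \<omega> k = n} \<in> sets borel"
proof -
  have "closed ((\<lambda>\<omega> :: nat \<Rightarrow> nat. \<omega> k) -` {n})"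
    by (intro closed_vimage) auto
  then show ?thesis
    by (simp add: vimage_def)
qed

lemma infinite_words_borel: "infinite_words N \<in> sets borel"
proof -
  have "infinite_words N = (\<Inter>k. \<Union>n\<in>{..<N}. {\<omega>. \<omega> k = n})"
    by (auto simp: infinite_words_def)
  then show ?thesis
    using coordinate_set_borel by auto
qed

lemma cylinder_words_borel: "cylinder N I \<in> sets (words_borel N)"
proof -
  have "cylinder N I = infinite_words N \<inter> (\<Inter>k\<in>{..<length I}. {\<omega>. \<omega> k = I ! k})"
    by (auto simp: cylinder_def)
  moreover have "(\<Inter>k\<in>{..<length I}. {\<omega> :: nat \<Rightarrow> nat. \<omega> k = I ! k}) \<in> sets borel"
    using coordinate_set_borel by (cases "I = []") (auto intro!: sets.finite_INT)
  ultimately show ?thesis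
    using infinite_words_borel by (auto simp: words_borel_def sets_restrict_space_iff cylinder_def)
qed

lemma singleton_words_borel: "\<omega> \<in> infinite_words N \<Longrightarrow> {\<omega>} \<in> sets (words_borel N)"
proof -
  assume "\<omega> \<in> infinite_words N"
  have "{\<omega>} = (\<Inter>k. {\<omega>'. \<omega>' k = \<omega> k})"
    by auto
  also have "\<dots> \<in> sets borel"
    using coordinate_set_borel by auto
  finally show ?thesis
    using \<open>\<omega> \<in> infinite_words N\<close> infinite_words_borel
    by (simp add: words_borel_def sets_restrict_space_iff)
qed

section \<open>Atoms of a representation\<close>

locale cuntz_representation =
  fixes N :: nat
    and S :: "nat \<Rightarrow> 'a::complex_hilbert_space \<Rightarrow> 'a"
  assumes cuntz: "cuntz_rep N UNIV S"
begin

definition Sadj :: "nat \<Rightarrow> 'a \<Rightarrow> 'a" where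
  "Sadj j = adjoint_on UNIV (S j)"

text \<open>As \<open>backshift (S j x) = x\<close> for every \<open>j\<close>, this operator plays the role of the shift
  \<open>\<sigma>\<close> of a permutative basis before any basis is at hand.\<close>

definition backshift :: "'a \<Rightarrow> 'a" where
  "backshift x = (\<Sum>j<N. Sadj j x)"

text \<open>For a word \<open>\<omega>\<close> over the alphabet this is the range of the projection \<open>P {\<omega>}\<close>, described without
  \<open>P\<close>: the vectors in the range of \<open>S\<close> along every finite prefix of \<open>\<omega>\<close>.\<close>

definition atom :: "(nat \<Rightarrow> nat) \<Rightarrow> 'a set" where
  "atom \<omega> = {x. \<forall>k. \<forall>j<N. j \<noteq> \<omega> k \<longrightarrow> Sadj j ((backshift ^^ k) x) = 0}"

text \<open>The vectors that may occur in the permutative bases constructed below.\<close>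

definition unit_atoms :: "'a set" where
  "unit_atoms = {x. norm x = 1 \<and> (\<exists>\<omega>\<in>infinite_words N. x \<in> atom \<omega>)}"

text \<open>For unit vectors in atoms this says that a product of operators \<open>S i\<close> and adjoints of them
  carries \<open>y\<close> to \<open>x\<close>; the formulation by iterates of \<open>backshift\<close> avoids words and makes it
  visibly an equivalence relation. It lifts tail equivalence of words to vectors.\<close>

definition same_orbit :: "'a \<Rightarrow> 'a \<Rightarrow> bool" where
  "same_orbit x y \<longleftrightarrow> (\<exists>m n. (backshift ^^ m) x = (backshift ^^ n) y)"

definition orbit :: "'a \<Rightarrow> 'a set" where
  "orbit e = {x \<in> unit_atoms. same_orbit x e}"

text \<open>Orthonormal families that are unions of orbits. Since \<open>S j x\<close> lies in the orbit of \<open>x\<close>, such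
  a family is a permutative basis of its closed span.\<close>

definition orbit_system :: "'a set \<Rightarrow> bool" where
  "orbit_system B \<longleftrightarrow> B \<subseteq> unit_atoms \<and>
     (\<forall>x\<in>B. \<forall>y\<in>B. x \<noteq> y \<longrightarrow> cinner x y = 0) \<and> (\<forall>x\<in>B. orbit x \<subseteq> B)"

lemma bounded_S: "j < N \<Longrightarrow> bounded_operator_on UNIV (S j)"
  using cuntz by (simp add: cuntz_rep_def)

lemma S_add: "j < N \<Longrightarrow> S j (x + y) = S j x + S j y"
  using bounded_S by (simp add: bounded_operator_on_def)

lemma Sadj_S: "i < N \<Longrightarrow> j < N \<Longrightarrow> Sadj i (S j x) = (if i = j then x else 0)"
  using cuntz by (simp add: cuntz_rep_def Sadj_def)

lemma sum_S_Sadj: "(\<Sum>i<N. S i (Sadj i x)) = x"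
  using cuntz by (simp add: cuntz_rep_def Sadj_def)

lemma cinner_S_left: "j < N \<Longrightarrow> cinner (S j x) y = cinner x (Sadj j y)"
  by (simp add: Sadj_def adjoint_on_UNIV bounded_S)

lemma cinner_Sadj_left: "j < N \<Longrightarrow> cinner (Sadj j x) y = cinner x (S j y)"
  by (metis cinner_S_left cinner_commute)

lemma Sadj_add: "j < N \<Longrightarrow> Sadj j (x + y) = Sadj j x + Sadj j y"
  by (rule cinner_ext) (simp add: cinner_add_right flip: cinner_S_left)

lemma Sadj_scaleC: "j < N \<Longrightarrow> Sadj j (scaleC c x) = scaleC c (Sadj j x)"
  by (rule cinner_ext) (simp add: cinner_scaleC_right flip: cinner_S_left)

lemma S_zero [simp]: "j < N \<Longrightarrow> S j 0 = 0"
  using S_add[of j 0 0] by simp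

lemma backshift_S [simp]: "j < N \<Longrightarrow> backshift (S j x) = x"
  by (simp add: backshift_def Sadj_S if_distrib sum.delta' cong: if_cong)

lemma norm_S: "j < N \<Longrightarrow> norm (S j x) = norm x"
proof -
  assume "j < N"
  then have "complex_of_real ((norm (S j x))\<^sup>2) = complex_of_real ((norm x)\<^sup>2)"
    by (simp only: cinner_self[symmetric] cinner_S_left) (simp add: Sadj_S)
  then show ?thesis
    by (simp only: of_real_eq_iff) simp
qed

lemma norm_Sadj_le:
  assumes "j < N"
  shows "norm (Sadj j x) \<le> norm x"
proof -
  have "complex_of_real ((norm x)\<^sup>2) = cinner (\<Sum>i<N. S i (Sadj i x)) x"
    by (simp only: sum_S_Sadj cinner_self)
  also have "\<dots> = (\<Sum>i<N. complex_of_real ((norm (Sadj i x))\<^sup>2))"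
    unfolding cinner_sum_left by (intro sum.cong) (simp_all only: cinner_self[symmetric] cinner_S_left lessThan_iff)
  finally have "(norm x)\<^sup>2 = (\<Sum>i<N. (norm (Sadj i x))\<^sup>2)"
    by (simp only: of_real_sum[symmetric] of_real_eq_iff)
  moreover have "(norm (Sadj j x))\<^sup>2 \<le> (\<Sum>i<N. (norm (Sadj i x))\<^sup>2)"
    using assms by (intro member_le_sum) auto
  ultimately show ?thesis
    by (metis norm_ge_zero power2_le_imp_le)
qed

lemma bounded_Sadj: "j < N \<Longrightarrow> bounded_operator_on UNIV (Sadj j)"
  unfolding bounded_operator_on_def
  using norm_Sadj_le by (auto simp: Sadj_add Sadj_scaleC intro!: exI[of _ 1])

lemma scaleC_atom:
  assumes "x \<in> atom \<omega>"
  shows "scaleC c x \<in> atom \<omega>"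
proof -
  have "(backshift ^^ k) (scaleC c x) = scaleC c ((backshift ^^ k) x)" for k
    by (induction k) (simp_all add: backshift_def Sadj_scaleC complex_vector.scale_sum_right)
  then show ?thesis
    using assms by (simp add: atom_def Sadj_scaleC)
qed

lemma backshift_atom: "x \<in> atom \<omega> \<Longrightarrow> backshift x \<in> atom (word_shift \<omega>)"
proof -
  assume x: "x \<in> atom \<omega>"
  have "Sadj j ((backshift ^^ k) (backshift x)) = 0" if "j < N" "j \<noteq> \<omega> (Suc k)" for j k
    using x that by (auto simp: atom_def funpow_swap1 dest: spec[of _ "Suc k"])
  then show ?thesis
    by (simp add: atom_def word_shift_def)
qed

lemma backshift_funpow_atom: "x \<in> atom \<omega> \<Longrightarrow> (backshift ^^ k) x \<in> atom ((word_shift ^^ k) \<omega>)"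
  by (induction k) (simp_all add: backshift_atom)

lemma Sadj_atom:
  assumes "\<omega> \<in> infinite_words N" "x \<in> atom \<omega>" "j < N"
  shows "Sadj j x = (if j = \<omega> 0 then backshift x else 0)"
proof -
  have other: "Sadj i x = 0" if "i < N" "i \<noteq> \<omega> 0" for i
    using assms(2) that by (auto simp: atom_def dest: spec[of _ 0])
  then have "backshift x = (\<Sum>i<N. if i = \<omega> 0 then Sadj i x else 0)"
    unfolding backshift_def by (intro sum.cong) auto
  then show ?thesis
    using assms other by (simp add: infinite_words_def)
qed

lemma S_backshift_atom:
  assumes "\<omega> \<in> infinite_words N" "x \<in> atom \<omega>"
  shows "S (\<omega> 0) (backshift x) = x"
proof -
  have "x = (\<Sum>i<N. if i = \<omega> 0 then S i (backshift x) else 0)"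
    by (subst sum_S_Sadj[symmetric], intro sum.cong) (auto simp: Sadj_atom[OF assms])
  then show ?thesis
    using assms(1) by (simp add: infinite_words_def)
qed

lemma S_atom:
  assumes "j < N" "x \<in> atom \<omega>"
  shows "S j x \<in> atom (case_nat j \<omega>)"
proof -
  have "Sadj i ((backshift ^^ k) (S j x)) = 0" if "i < N" "i \<noteq> case_nat j \<omega> k" for i k
    using assms that by (cases k) (auto simp: atom_def Sadj_S funpow_swap1)
  then show ?thesis
    by (simp add: atom_def)
qed

lemma norm_backshift:
  assumes "\<omega> \<in> infinite_words N" "x \<in> atom \<omega>"
  shows "norm (backshift x) = norm x"
  using S_backshift_atom[OF assms] norm_S[of "\<omega> 0" "backshift x"] assms(1)
  by (simp add: infinite_words_def)

text \<open>On an atom \<open>backshift\<close> is undone by the single operator \<open>S (\<omega> 0)\<close>.\<close>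

lemma backshift_funpow_inj:
  assumes "\<omega> \<in> infinite_words N" "x \<in> atom \<omega>" "y \<in> atom \<omega>" "(backshift ^^ k) x = (backshift ^^ k) y"
  shows "x = y"
  using assms
proof (induction k arbitrary: \<omega> x y)
  case (Suc k)
  have "backshift x = backshift y"
    by (rule Suc.IH[of "word_shift \<omega>"])
      (use Suc.prems in \<open>simp_all add: word_shift_infinite_words backshift_atom funpow_swap1\<close>)
  then show ?case
    using S_backshift_atom Suc.prems by metis
qed simp

text \<open>Up to the first letter where the two words differ, \<open>backshift\<close> preserves the inner product;
  there the two vectors lie in the ranges of different \<open>S j\<close>.\<close>

lemma atoms_orthogonal:
  assumes "\<omega> \<in> infinite_words N" "\<omega>' \<in> infinite_words N" "x \<in> atom \<omega>" "y \<in> atom \<omega>'" "\<omega> \<noteq> \<omega>'"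
  shows "cinner x y = 0"
proof -
  obtain k where "\<omega> k \<noteq> \<omega>' k"
    using assms(5) by blast
  then show ?thesis
    using assms(1-4)
  proof (induction k arbitrary: \<omega> \<omega>' x y)
    case 0
    have "\<omega> 0 < N"
      using 0 by (simp add: infinite_words_def)
    then have "cinner (S (\<omega> 0) (backshift x)) y = 0"
      using 0 by (simp add: cinner_S_left Sadj_atom)
    then show ?case
      using 0 by (simp add: S_backshift_atom)
  next
    case (Suc k)
    show ?case
    proof (cases "\<omega> 0 = \<omega>' 0")
      case True
      have "word_shift \<omega> k \<noteq> word_shift \<omega>' k"
        using Suc.prems(1) by (simp add: word_shift_def)
      moreover have "word_shift \<omega> \<in> infinite_words N" "word_shift \<omega>' \<in> infinite_words N"
        "backshift x \<in> atom (word_shift \<omega>)" "backshift y \<in> atom (word_shift \<omega>')"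
        using Suc.prems word_shift_infinite_words backshift_atom by blast+
      ultimately have "cinner (backshift x) (backshift y) = 0"
        by (rule Suc.IH)
      have "\<omega> 0 < N"
        using Suc.prems by (simp add: infinite_words_def)
      then have "cinner (S (\<omega> 0) (backshift x)) y = cinner (backshift x) (backshift y)"
        using Suc.prems True by (simp add: cinner_S_left Sadj_atom)
      also have "\<dots> = 0"
        by fact
      finally show ?thesis
        using Suc.prems by (simp add: S_backshift_atom)
    next
      case False
      have "\<omega> 0 < N"
        using Suc.prems by (simp add: infinite_words_def)
      then have "cinner (S (\<omega> 0) (backshift x)) y = 0"
        using Suc.prems False by (simp add: cinner_S_left Sadj_atom)
      then show ?thesis
        using Suc.prems by (simp add: S_backshift_atom)
    qed
  qed
qed

lemma atom_unique:
  assumes "\<omega> \<in> infinite_words N" "\<omega>' \<in> infinite_words N" "x \<in> atom \<omega>" "x \<in> atom \<omega>'" "x \<noteq> 0"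
  shows "\<omega> = \<omega>'"
  using atoms_orthogonal[OF assms(1-4)] assms(5) by auto

section \<open>Orbits and permutative bases\<close>

lemma unit_atomsE:
  assumes "x \<in> unit_atoms"
  obtains \<omega> where "norm x = 1" "\<omega> \<in> infinite_words N" "x \<in> atom \<omega>"
  using assms by (auto simp: unit_atoms_def)

lemma unit_atoms_nonzero: "x \<in> unit_atoms \<Longrightarrow> x \<noteq> 0"
  by (auto simp: unit_atoms_def)

lemma S_unit_atoms:
  assumes "j < N" "x \<in> unit_atoms"
  shows "S j x \<in> unit_atoms"
proof -
  obtain \<omega> where "norm x = 1" "\<omega> \<in> infinite_words N" "x \<in> atom \<omega>"
    using assms(2) by (rule unit_atomsE)
  moreover from this have "case_nat j \<omega> \<in> infinite_words N"
    using assms(1) by (auto simp: infinite_words_def split: nat.split)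
  ultimately show ?thesis
    using assms(1) S_atom[of j x \<omega>] by (auto simp: unit_atoms_def norm_S)
qed

lemma backshift_unit_atoms:
  assumes "x \<in> unit_atoms"
  shows "backshift x \<in> unit_atoms"
proof -
  obtain \<omega> where "norm x = 1" "\<omega> \<in> infinite_words N" "x \<in> atom \<omega>"
    using assms by (rule unit_atomsE)
  then show ?thesis
    using norm_backshift[of \<omega> x] backshift_atom[of x \<omega>] word_shift_infinite_words[of \<omega>]
    by (auto simp: unit_atoms_def)
qed

lemma same_orbit_refl [simp]: "same_orbit x x"
  unfolding same_orbit_def by blast

lemma same_orbit_sym: "same_orbit x y \<Longrightarrow> same_orbit y x"
  unfolding same_orbit_def by metis

lemma same_orbit_trans:
  assumes "same_orbit x y" "same_orbit y z"
  shows "same_orbit x z"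
proof -
  obtain m n p q where mn: "(backshift ^^ m) x = (backshift ^^ n) y"
    and pq: "(backshift ^^ p) y = (backshift ^^ q) z"
    using assms unfolding same_orbit_def by blast
  have "(backshift ^^ (p + m)) x = (backshift ^^ (p + n)) y"
    by (simp add: funpow_add mn)
  also have "\<dots> = (backshift ^^ (n + p)) y"
    by (simp only: add.commute)
  also have "\<dots> = (backshift ^^ (n + q)) z"
    by (simp add: funpow_add pq)
  finally show ?thesis
    unfolding same_orbit_def by blast
qed

lemma same_orbit_backshift: "same_orbit (backshift x) x"
  unfolding same_orbit_def by (rule exI[of _ 0], rule exI[of _ 1]) simp

lemma same_orbit_S: "j < N \<Longrightarrow> same_orbit (S j x) x"
  unfolding same_orbit_def by (rule exI[of _ 1], rule exI[of _ 0]) simp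

lemma orbit_eqI: "same_orbit x y \<Longrightarrow> orbit x = orbit y"
  unfolding orbit_def using same_orbit_sym same_orbit_trans by blast

lemma orbit_self: "x \<in> unit_atoms \<Longrightarrow> x \<in> orbit x"
  by (simp add: orbit_def)

lemma orbit_systemD:
  assumes "orbit_system B"
  shows "B \<subseteq> unit_atoms"
    and "\<And>x y. x \<in> B \<Longrightarrow> y \<in> B \<Longrightarrow> x \<noteq> y \<Longrightarrow> cinner x y = 0"
    and "\<And>x. x \<in> B \<Longrightarrow> orbit x \<subseteq> B"
  using assms by (auto simp: orbit_system_def)

lemma orbit_system_S:
  assumes "orbit_system B" "x \<in> B" "j < N"
  shows "S j x \<in> B"
  using orbit_systemD[OF assms(1)] assms same_orbit_S S_unit_atoms unfolding orbit_def by blast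

lemma orbit_system_backshift:
  assumes "orbit_system B" "x \<in> B"
  shows "backshift x \<in> B"
  using orbit_systemD[OF assms(1)] assms same_orbit_backshift backshift_unit_atoms
  unfolding orbit_def by blast

lemma orbit_system_Sadj:
  assumes "orbit_system B" "x \<in> B" "j < N"
  shows "Sadj j x \<in> insert 0 B"
proof -
  obtain \<omega> where "\<omega> \<in> infinite_words N" "x \<in> atom \<omega>"
    using orbit_systemD(1)[OF assms(1)] assms(2) unit_atomsE by blast
  then show ?thesis
    using Sadj_atom[of \<omega> x j] assms orbit_system_backshift by simp
qed

text \<open>Both \<open>S j\<close> and its adjoint map \<open>B\<close> into \<open>B \<union> {0}\<close>, so the closed span of \<open>B\<close> reduces the
  representation, and the adjoint of \<open>S j\<close> within this subspace is the restriction of the adjoint in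
  the whole space.\<close>

lemma permutative_basis_orbit_system:
  assumes B: "orbit_system B"
  defines "M \<equiv> closure (complex_vector.span B)"
  shows "cuntz_rep N M S" "permutative_basis N M S B"
proof -
  have M: "closed_csubspace M"
    unfolding M_def by (rule closed_csubspace_closure_span)
  have "B \<subseteq> M"
    unfolding M_def by (rule subset_closure_span)
  have "0 \<in> M"
    using M complex_vector.subspace_0 by (auto simp: closed_csubspace_def)
  have "S j ` B \<subseteq> M" if "j < N" for j
    using orbit_system_S[OF B _ that] \<open>B \<subseteq> M\<close> by blast
  then have S_M: "S j x \<in> M" if "j < N" "x \<in> M" for j x
    using bounded_operator_closure_span[OF bounded_S M] that unfolding M_def by blast
  have "Sadj j ` B \<subseteq> M" if "j < N" for j
    using orbit_system_Sadj[OF B _ that] \<open>B \<subseteq> M\<close> \<open>0 \<in> M\<close> by fastforce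
  then have Sadj_M: "Sadj j x \<in> M" if "j < N" "x \<in> M" for j x
    using bounded_operator_closure_span[OF bounded_Sadj M] that unfolding M_def by blast
  have adjoint: "adjoint_on M (S j) y = Sadj j y" if "j < N" "y \<in> M" for j y
    by (rule adjoint_on_eqI) (simp_all add: that Sadj_M cinner_S_left)
  have "bounded_operator_on M (S j)" if "j < N" for j
    using bounded_S[OF that] S_M[OF that] unfolding bounded_operator_on_def by blast
  moreover have "(\<Sum>i<N. S i (adjoint_on M (S i) x)) = x" if "x \<in> M" for x
  proof -
    have "(\<Sum>i<N. S i (adjoint_on M (S i) x)) = (\<Sum>i<N. S i (Sadj i x))"
      using that by (intro sum.cong) (simp_all add: adjoint)
    then show ?thesis
      by (simp add: sum_S_Sadj)
  qed
  ultimately show "cuntz_rep N M S"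
    using M by (auto simp: cuntz_rep_def adjoint S_M Sadj_S)
  have "cinner e e = 1" if "e \<in> B" for e
    using that orbit_systemD(1)[OF B] by (auto simp: cinner_self unit_atoms_def)
  then show "permutative_basis N M S B"
    using orbit_systemD[OF B] orbit_system_S[OF B]
    by (auto simp: permutative_basis_def orthonormal_basis_of_def M_def)
qed

lemma basis_shift_orbit_system:
  assumes B: "orbit_system B" and e: "e \<in> B"
  shows "basis_shift N S B e = backshift e"
  unfolding basis_shift_def
proof (rule the_equality)
  obtain \<omega> where "\<omega> \<in> infinite_words N" "e \<in> atom \<omega>"
    using orbit_systemD(1)[OF B] e unit_atomsE by blast
  then have "\<omega> 0 < N" "S (\<omega> 0) (backshift e) = e"
    by (auto simp: infinite_words_def S_backshift_atom)
  then show "backshift e \<in> B \<and> (\<exists>j<N. S j (backshift e) = e)"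
    using orbit_system_backshift[OF B e] by blast
qed auto

text \<open>The shift on the basis is \<open>backshift\<close>, and the \<open>k\<close>-th backshift of a vector in the atom of \<open>\<omega>\<close> is in
  the range of \<open>S (\<omega> k)\<close>, so the code can be read off the atom.\<close>

lemma coding_map_orbit_system:
  assumes B: "orbit_system B" and e: "e \<in> B" and \<omega>: "\<omega> \<in> infinite_words N" "e \<in> atom \<omega>"
  shows "coding_map N S B e = \<omega>"
proof
  fix k
  have iter: "(backshift ^^ k) e \<in> B \<and> (basis_shift N S B ^^ k) e = (backshift ^^ k) e" for k
    by (induction k) (auto simp: e B basis_shift_orbit_system orbit_system_backshift)
  let ?f = "(backshift ^^ k) e" and ?\<tau> = "(word_shift ^^ k) \<omega>"
  have \<tau>: "?\<tau> \<in> infinite_words N" "?\<tau> 0 = \<omega> k"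
    using \<omega>(1) by (auto simp: infinite_words_def word_shift_funpow_nth)
  have f: "?f \<in> B" "?f \<in> atom ?\<tau>"
    using iter backshift_funpow_atom \<omega> by auto
  have "?f \<in> S (\<omega> k) ` B"
    using S_backshift_atom[OF \<tau>(1) f(2)] \<tau>(2) orbit_system_backshift[OF B f(1)]
    by (metis image_eqI)
  moreover have "j = \<omega> k" if j: "j < N" "?f \<in> S j ` B" for j
  proof (rule ccontr)
    assume "j \<noteq> \<omega> k"
    then have "Sadj j ?f = 0"
      using Sadj_atom[OF \<tau>(1) f(2) j(1)] \<tau>(2) by simp
    moreover obtain g where "g \<in> B" "?f = S j g"
      using j(2) by blast
    ultimately have "g = 0"
      using j(1) by (simp add: Sadj_S)
    then show False
      using \<open>g \<in> B\<close> orbit_systemD(1)[OF B] unit_atoms_nonzero by blast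
  qed
  ultimately show "coding_map N S B e k = \<omega> k"
    using iter[of k] \<omega>(1) unfolding coding_map_def by (auto simp: infinite_words_def)
qed

text \<open>Orthogonality to \<open>B\<close> passes from a vector to its images under \<open>S j\<close> and the adjoints, because
  all these operators leave \<open>B \<union> {0}\<close> invariant. Going from \<open>e\<close> to \<open>f\<close> it is first pushed
  forward along \<open>backshift\<close> and then pulled back.\<close>

lemma orthogonal_orbit:
  assumes B: "orbit_system B" and e: "\<And>b. b \<in> B \<Longrightarrow> cinner e b = 0"
    and f: "f \<in> orbit e" and b: "b \<in> B"
  shows "cinner f b = 0"
proof -
  obtain m n where mn: "(backshift ^^ m) f = (backshift ^^ n) e" and "f \<in> unit_atoms"
    using f by (auto simp: orbit_def same_orbit_def)
  have "\<forall>b\<in>B. cinner ((backshift ^^ n) e) b = 0"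
  proof (induction n)
    case (Suc n)
    then show ?case
      by (simp add: backshift_def[of "(backshift ^^ n) e"] cinner_sum_left cinner_Sadj_left
          orbit_system_S[OF B])
  qed (use e in simp)
  then have "\<forall>b\<in>B. cinner ((backshift ^^ m) f) b = 0"
    by (simp add: mn)
  then have "\<forall>b\<in>B. cinner f b = 0"
    using \<open>f \<in> unit_atoms\<close>
  proof (induction m arbitrary: f)
    case (Suc m)
    have step: "\<forall>b\<in>B. cinner (backshift f) b = 0"
      by (rule Suc.IH) (use Suc.prems in \<open>simp_all add: funpow_swap1 backshift_unit_atoms\<close>)
    obtain \<omega> where \<omega>: "\<omega> \<in> infinite_words N" "f \<in> atom \<omega>"
      using Suc.prems(2) unit_atomsE by blast
    then have "\<omega> 0 < N"
      by (simp add: infinite_words_def)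
    show ?case
    proof
      fix b assume "b \<in> B"
      have "cinner f b = cinner (backshift f) (Sadj (\<omega> 0) b)"
        using S_backshift_atom[OF \<omega>] cinner_S_left[OF \<open>\<omega> 0 < N\<close>] by metis
      then show "cinner f b = 0"
        using orbit_system_Sadj[OF B \<open>b \<in> B\<close> \<open>\<omega> 0 < N\<close>] step by auto
    qed
  qed simp
  then show ?thesis
    using b by blast
qed

lemma backshift_funpow_word_op:
  "set I \<subseteq> {..<N} \<Longrightarrow> (backshift ^^ length I) (word_op S I x) = x"
  by (induction I) (simp_all add: funpow_Suc_right del: funpow.simps)

text \<open>A vector in the range of \<open>S\<close> along the prefix of length \<open>k + 1\<close> is moved by \<open>k\<close> backshifts into
  the range of \<open>S (\<omega> k)\<close>, where the other adjoints vanish.\<close>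

lemma atomI:
  assumes \<omega>: "\<omega> \<in> infinite_words N" and x: "\<And>n. x \<in> range (word_op S (map \<omega> [0..<n]))"
  shows "x \<in> atom \<omega>"
proof -
  have "Sadj j ((backshift ^^ k) x) = 0" if "j < N" "j \<noteq> \<omega> k" for j k
  proof -
    have letters: "\<omega> n < N" for n
      using \<omega> by (simp add: infinite_words_def)
    obtain z where "x = word_op S (map \<omega> [0..<Suc k]) z"
      using x by blast
    then have "x = word_op S (map \<omega> [0..<k]) (S (\<omega> k) z)"
      by (simp add: word_op_append)
    moreover have "set (map \<omega> [0..<k]) \<subseteq> {..<N}"
      using letters by auto
    ultimately have "(backshift ^^ k) x = S (\<omega> k) z"
      using backshift_funpow_word_op[of "map \<omega> [0..<k]"] by simp
    then show ?thesis
      using that letters by (simp add: Sadj_S)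
  qed
  then show ?thesis
    by (simp add: atom_def)
qed

end

section \<open>Aperiodic purely atomic representations\<close>

locale aperiodic_atomic_representation = cuntz_representation +
  fixes P :: "(nat \<Rightarrow> nat) set \<Rightarrow> 'a \<Rightarrow> 'a" and \<Omega> :: "(nat \<Rightarrow> nat) set"
  assumes pvm: "associated_pvm N UNIV S P"
    and atomic: "purely_atomic_supported_on N UNIV P \<Omega>"
    and aperiodic: "aperiodic_set \<Omega>"
begin

lemma P_atom:
  assumes \<omega>: "\<omega> \<in> infinite_words N"
  shows "P {\<omega>} x \<in> atom \<omega>"
proof (rule atomI[OF \<omega>])
  fix n
  let ?I = "map \<omega> [0..<n]"
  have "cylinder N ?I \<inter> {\<omega>} = {\<omega>}"
    using \<omega> by (auto simp: cylinder_def)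
  then have "P {\<omega>} x = P (cylinder N ?I) (P {\<omega>} x)"
    using pvm cylinder_words_borel[of N ?I] singleton_words_borel[OF \<omega>]
    unfolding associated_pvm_def projection_valued_measure_def by (metis UNIV_I)
  also have "\<dots> \<in> range (word_op S ?I)"
  proof -
    have "set ?I \<subseteq> {..<N}"
      using \<omega> by (auto simp: infinite_words_def)
    then show ?thesis
      using pvm unfolding associated_pvm_def by (metis UNIV_I rangeI)
  qed
  finally show "P {\<omega>} x \<in> range (word_op S ?I)" .
qed

lemma cinner_P:
  assumes "\<omega> \<in> infinite_words N"
  shows "cinner (P {\<omega>} x) y = cinner x (P {\<omega>} y)"
  using pvm singleton_words_borel[OF assms]
  by (auto simp: associated_pvm_def projection_valued_measure_def orthogonal_projection_on_def)

lemma support_words: "\<omega> \<in> \<Omega> \<Longrightarrow> \<omega> \<in> infinite_words N"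
  using atomic by (auto simp: purely_atomic_supported_on_def)

lemma sum_of_atoms: "((\<lambda>\<omega>. P {\<omega>} x) has_sum x) \<Omega>"
  using atomic by (auto simp: purely_atomic_supported_on_def)

lemma P_other_atom:
  assumes "\<omega> \<in> infinite_words N" "\<omega>' \<in> infinite_words N" "x \<in> atom \<omega>'" "\<omega> \<noteq> \<omega>'"
  shows "P {\<omega>} x = 0"
proof -
  have "cinner (P {\<omega>} (P {\<omega>} x)) x = 0"
    using assms P_atom atoms_orthogonal by blast
  then show ?thesis
    using cinner_P[OF assms(1), of "P {\<omega>} x" x] by (metis cinner_self_eq_zero)
qed

text \<open>All but one of the terms in the expansion of a vector \<open>x\<close> of an atom vanish, so the remaining
  term must be present and equal to \<open>x\<close>. This carries aperiodicity over from \<open>\<Omega>\<close> to every word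
  with a nonzero atom.\<close>

lemma atom_in_support:
  assumes "\<omega> \<in> infinite_words N" "x \<in> atom \<omega>" "x \<noteq> 0"
  shows "\<omega> \<in> \<Omega>" "P {\<omega>} x = x"
proof -
  show "\<omega> \<in> \<Omega>"
  proof (rule ccontr)
    assume "\<omega> \<notin> \<Omega>"
    then have "P {\<omega>'} x = 0" if "\<omega>' \<in> \<Omega>" for \<omega>'
      using that P_other_atom[OF support_words[OF that] assms(1,2)] by auto
    then have "((\<lambda>\<omega>. P {\<omega>} x) has_sum 0) \<Omega>"
      by (rule has_sum_0)
    then show False
      using sum_of_atoms[of x] has_sum_unique assms(3) by blast
  qed
  moreover have "((\<lambda>\<omega>. P {\<omega>} x) has_sum P {\<omega>} x) {\<omega>}"
    using has_sum_finite[of "{\<omega>}" "\<lambda>\<omega>. P {\<omega>} x"] by simp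
  ultimately have "((\<lambda>\<omega>. P {\<omega>} x) has_sum P {\<omega>} x) \<Omega>"
    using P_other_atom[OF support_words assms(1,2)]
    by (subst has_sum_cong_neutral[where T = "{\<omega>}" and g = "\<lambda>\<omega>. P {\<omega>} x"]) auto
  then show "P {\<omega>} x = x"
    using sum_of_atoms[of x] has_sum_unique by blast
qed

text \<open>Some component \<open>P {\<omega>} x\<close> is nonzero. It inherits orthogonality to vectors \<open>z\<close> in atoms
  because \<open>P {\<omega>}\<close> is self-adjoint and either fixes or kills \<open>z\<close>.\<close>

lemma atomic_component:
  assumes "x \<noteq> 0"
  obtains \<omega> y where "\<omega> \<in> infinite_words N" "y \<in> atom \<omega>" "y \<noteq> 0"
    "\<And>z. z \<in> unit_atoms \<Longrightarrow> cinner x z = 0 \<Longrightarrow> cinner y z = 0"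
proof -
  obtain \<omega> where \<omega>: "\<omega> \<in> \<Omega>" "P {\<omega>} x \<noteq> 0"
    using has_sum_0[of \<Omega> "\<lambda>\<omega>. P {\<omega>} x"] sum_of_atoms[of x] has_sum_unique assms by blast
  have "cinner (P {\<omega>} x) z = 0" if z: "z \<in> unit_atoms" "cinner x z = 0" for z
  proof -
    obtain \<omega>' where \<omega>': "\<omega>' \<in> infinite_words N" "z \<in> atom \<omega>'"
      using z unit_atomsE by blast
    have "P {\<omega>} z = z \<or> P {\<omega>} z = 0"
      using atom_in_support(2)[OF \<omega>'] unit_atoms_nonzero[OF z(1)]
        P_other_atom[OF support_words[OF \<omega>(1)] \<omega>'] by blast
    then show ?thesis
      using cinner_P[OF support_words[OF \<omega>(1)]] z(2) by auto
  qed
  then show ?thesis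
    using that \<omega> support_words P_atom by blast
qed

text \<open>This is where aperiodicity enters. Iterated backshifts carry \<open>x\<close> and \<open>y\<close> to iterates of \<open>e\<close>;
  if \<open>x\<close> and \<open>y\<close> are shifted equally often, these two iterates lie in the same atom, which for an
  aperiodic word forces them to be the same iterate. If a power of the shift
  fixes \<open>\<omega>\<close>, the same power of \<open>backshift\<close> maps the atom to itself, and it need not be the identity
  there.\<close>

lemma same_orbit_same_atom:
  assumes \<omega>: "\<omega> \<in> infinite_words N" "x \<in> atom \<omega>" "y \<in> atom \<omega>" "x \<noteq> 0"
    and e: "e \<in> unit_atoms" "same_orbit x e" "same_orbit y e"
  shows "x = y"
proof -
  obtain m n where x: "(backshift ^^ m) x = (backshift ^^ n) e"
    using e unfolding same_orbit_def by blast
  obtain p q where y: "(backshift ^^ p) y = (backshift ^^ q) e"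
    using e unfolding same_orbit_def by blast
  obtain \<tau> where \<tau>: "\<tau> \<in> infinite_words N" "e \<in> atom \<tau>"
    using e unit_atomsE by blast
  have \<omega>s: "(word_shift ^^ k) \<omega> \<in> infinite_words N" "(word_shift ^^ k) \<tau> \<in> infinite_words N" for k
    using \<omega> \<tau> by (auto simp: infinite_words_def word_shift_funpow_nth)
  have e_nz: "(backshift ^^ k) e \<noteq> 0" for k
  proof -
    have "(backshift ^^ k) e \<in> unit_atoms"
      by (induction k) (simp_all add: e backshift_unit_atoms)
    then show ?thesis
      by (rule unit_atoms_nonzero)
  qed
  have x': "(backshift ^^ (p + m)) x = (backshift ^^ (p + n)) e"
    by (simp add: funpow_add x)
  have "(backshift ^^ (m + p)) y = (backshift ^^ (m + q)) e"
    by (simp add: funpow_add y)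
  then have y': "(backshift ^^ (p + m)) y = (backshift ^^ (m + q)) e"
    by (simp add: add.commute)
  have "(word_shift ^^ (p + m)) \<omega> = (word_shift ^^ (p + n)) \<tau>"
    using atom_unique[OF \<omega>s] backshift_funpow_atom \<omega>(2) \<tau>(2) x' e_nz by metis
  moreover have "(word_shift ^^ (p + m)) \<omega> = (word_shift ^^ (m + q)) \<tau>"
    using atom_unique[OF \<omega>s] backshift_funpow_atom \<omega>(3) \<tau>(2) y' e_nz by metis
  moreover have "\<not> periodic_word \<tau>"
    using atom_in_support(1)[OF \<tau>] unit_atoms_nonzero[OF e(1)] aperiodic
    by (auto simp: aperiodic_set_def)
  ultimately have "p + n = m + q"
    unfolding periodic_word_def by metis
  then show ?thesis
    using backshift_funpow_inj[OF \<omega>(1-3), of "p + m"] x' y' by simp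
qed

lemma orbit_system_orbit:
  assumes e: "e \<in> unit_atoms"
  shows "orbit_system (orbit e)"
proof -
  have "cinner x y = 0" if "x \<in> orbit e" "y \<in> orbit e" "x \<noteq> y" for x y
  proof -
    have xy: "x \<in> unit_atoms" "y \<in> unit_atoms" "same_orbit x e" "same_orbit y e"
      using that by (auto simp: orbit_def)
    obtain \<omega> where \<omega>: "\<omega> \<in> infinite_words N" "x \<in> atom \<omega>"
      using xy unit_atomsE by blast
    obtain \<omega>' where \<omega>': "\<omega>' \<in> infinite_words N" "y \<in> atom \<omega>'"
      using xy unit_atomsE by blast
    have "\<omega> \<noteq> \<omega>'"
      using same_orbit_same_atom[OF \<omega> _ _ e] \<omega>' xy unit_atoms_nonzero that(3) by blast
    then show ?thesis
      using atoms_orthogonal \<omega> \<omega>' by blast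
  qed
  moreover have "orbit x \<subseteq> orbit e" if "x \<in> orbit e" for x
    using that orbit_eqI by (auto simp: orbit_def)
  ultimately show ?thesis
    unfolding orbit_system_def by (auto simp: orbit_def)
qed

text \<open>A maximal orbit system spans a dense subspace: otherwise a component of a vector orthogonal to
  it would yield an orbit orthogonal to it, which could be adjoined.\<close>

lemma orbit_system_spanning:
  obtains B where "orbit_system B" "closure (complex_vector.span B) = UNIV"
proof -
  have "\<exists>B\<in>Collect orbit_system. \<forall>X\<in>Collect orbit_system. B \<subseteq> X \<longrightarrow> X = B"
  proof (rule subset_Zorn')
    fix C assume C: "subset.chain (Collect orbit_system) C"
    then have C_systems: "orbit_system B" if "B \<in> C" for B
      using that by (auto simp: subset.chain_def)
    have "cinner x y = 0" if xy: "x \<in> \<Union>C" "y \<in> \<Union>C" "x \<noteq> y" for x y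
    proof -
      obtain B B' where BB: "B \<in> C" "x \<in> B" "B' \<in> C" "y \<in> B'"
        using xy by blast
      then have "B \<subseteq> B' \<or> B' \<subseteq> B"
        using C unfolding subset.chain_def by blast
      then show ?thesis
        using BB xy(3) orbit_systemD(2)[OF C_systems] by blast
    qed
    moreover have "\<Union>C \<subseteq> unit_atoms"
      using orbit_systemD(1)[OF C_systems] by blast
    moreover have "orbit x \<subseteq> \<Union>C" if "x \<in> \<Union>C" for x
      using that orbit_systemD(3)[OF C_systems] by blast
    ultimately show "\<Union>C \<in> Collect orbit_system"
      unfolding orbit_system_def by blast
  qed
  then obtain B where B: "orbit_system B" and max: "\<And>X. orbit_system X \<Longrightarrow> B \<subseteq> X \<Longrightarrow> X = B"
    by auto
  have "closure (complex_vector.span B) = UNIV"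
  proof (rule ccontr)
    assume "closure (complex_vector.span B) \<noteq> UNIV"
    then obtain x where x: "x \<noteq> 0" "\<And>b. b \<in> closure (complex_vector.span B) \<Longrightarrow> cinner b x = 0"
      using orthogonal_vector_exists[OF closed_csubspace_closure_span] by blast
    obtain \<omega> y where y: "\<omega> \<in> infinite_words N" "y \<in> atom \<omega>" "y \<noteq> 0"
      "\<And>z. z \<in> unit_atoms \<Longrightarrow> cinner x z = 0 \<Longrightarrow> cinner y z = 0"
      using atomic_component[OF x(1)] by blast
    have y_B: "cinner y b = 0" if "b \<in> B" for b
      using y(4) x(2) subset_closure_span orbit_systemD(1)[OF B] that cinner_eq_zero_commute
      by (metis subset_iff)
    define e where "e = scaleC (1 / norm y) y"
    have "norm e = 1"
      using y(3) by (simp add: e_def norm_scaleC norm_divide)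
    moreover have "e \<in> atom \<omega>"
      using y(2) by (simp add: e_def scaleC_atom)
    ultimately have e: "e \<in> unit_atoms"
      using y(1) by (auto simp: unit_atoms_def)
    have e_B: "cinner e b = 0" if "b \<in> B" for b
      using y_B[OF that] by (simp add: e_def cinner_scaleC_left)
    have cross: "cinner f b = 0" if "f \<in> orbit e" "b \<in> B" for f b
      using orthogonal_orbit[OF B e_B] that by blast
    have "cinner u v = 0" if "u \<in> B \<union> orbit e" "v \<in> B \<union> orbit e" "u \<noteq> v" for u v
      using that cross cinner_eq_zero_commute orbit_systemD(2)[OF B]
        orbit_systemD(2)[OF orbit_system_orbit[OF e]] by (metis Un_iff)
    moreover have "B \<union> orbit e \<subseteq> unit_atoms"
      using orbit_systemD(1)[OF B] by (auto simp: orbit_def)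
    moreover have "orbit u \<subseteq> B \<union> orbit e" if "u \<in> B \<union> orbit e" for u
      using that orbit_systemD(3)[OF B] orbit_systemD(3)[OF orbit_system_orbit[OF e]] by blast
    ultimately have "orbit_system (B \<union> orbit e)"
      unfolding orbit_system_def by blast
    then have "e \<in> B"
      using max[of "B \<union> orbit e"] orbit_self[OF e] by blast
    then show False
      using e_B[of e] unit_atoms_nonzero[OF e] by simp
  qed
  then show ?thesis
    using that B by blast
qed

text \<open>The summands are the closed spans of the single orbits in a spanning orbit system: within one
  orbit no atom contains two vectors, which is injectivity of the coding map.\<close>

lemma permutative_decomposition:
  "permutative N UNIV S \<and>
    (\<exists>\<M>. orthogonal_direct_sum UNIV \<M> \<and> (\<forall>M\<in>\<M>. permutative_injective N M S))"
proof -
  obtain B where B: "orbit_system B" and dense: "closure (complex_vector.span B) = UNIV"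
    by (rule orbit_system_spanning)
  define \<M> where "\<M> = (\<lambda>e. closure (complex_vector.span (orbit e))) ` B"
  have unit: "e \<in> unit_atoms" if "e \<in> B" for e
    using that orbit_systemD(1)[OF B] by blast
  have "permutative N UNIV S"
    using permutative_basis_orbit_system[OF B] cuntz unfolding dense permutative_def by blast
  moreover have "permutative_injective N M S" if M: "M \<in> \<M>" for M
  proof -
    obtain e where e: "e \<in> B" "M = closure (complex_vector.span (orbit e))"
      using M by (auto simp: \<M>_def)
    have sys: "orbit_system (orbit e)"
      by (rule orbit_system_orbit[OF unit[OF e(1)]])
    have "inj_on (coding_map N S (orbit e)) (orbit e)"
    proof (rule inj_onI)
      fix x y assume x: "x \<in> orbit e" and y: "y \<in> orbit e"
        and eq: "coding_map N S (orbit e) x = coding_map N S (orbit e) y"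
      obtain \<omega> where \<omega>: "\<omega> \<in> infinite_words N" "x \<in> atom \<omega>"
        using x unit_atomsE by (auto simp: orbit_def)
      obtain \<omega>' where \<omega>': "\<omega>' \<in> infinite_words N" "y \<in> atom \<omega>'"
        using y unit_atomsE by (auto simp: orbit_def)
      have "\<omega> = \<omega>'"
        using eq coding_map_orbit_system[OF sys] x y \<omega> \<omega>' by metis
      then show "x = y"
        using same_orbit_same_atom[OF \<omega> _ _ unit[OF e(1)]] \<omega>' x y unit_atoms_nonzero
        by (auto simp: orbit_def)
    qed
    then show ?thesis
      using permutative_basis_orbit_system[OF sys] e(2) unfolding permutative_injective_def by blast
  qed
  moreover have "orthogonal_direct_sum UNIV \<M>"
    unfolding orthogonal_direct_sum_def
  proof (intro conjI ballI impI)
    show "closed_csubspace M" if "M \<in> \<M>" for M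
      using that by (auto simp: \<M>_def closed_csubspace_closure_span)
    show "cinner x y = 0" if MM: "M \<in> \<M>" "M' \<in> \<M>" "M \<noteq> M'" "x \<in> M" "y \<in> M'" for M M' x y
    proof -
      obtain e e' where e: "e \<in> B" "M = closure (complex_vector.span (orbit e))"
        "e' \<in> B" "M' = closure (complex_vector.span (orbit e'))"
        using MM(1,2) by (auto simp: \<M>_def)
      have "cinner u v = 0" if "u \<in> orbit e" "v \<in> orbit e'" for u v
      proof -
        have "orbit u = orbit e" "orbit v = orbit e'"
          using that orbit_eqI by (auto simp: orbit_def)
        then have "u \<noteq> v"
          using MM(3) e by auto
        then show ?thesis
          using orbit_systemD(2,3)[OF B] that e(1,3) by blast
      qed
      then show ?thesis
        using closure_span_orthogonal[of "orbit e" "orbit e'"] MM(4,5) e(2,4) by blast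
    qed
    have "B \<subseteq> \<Union>\<M>"
      using orbit_self[OF unit] subset_closure_span by (fastforce simp: \<M>_def)
    then have "closure (complex_vector.span B) \<subseteq> closure (complex_vector.span (\<Union>\<M>))"
      by (intro closure_mono complex_vector.span_mono)
    then show "closure (complex_vector.span (\<Union>\<M>)) = UNIV"
      using dense by blast
  qed
  ultimately show ?thesis
    by blast
qed

end

theorem theorem4p13:
  fixes N :: nat
    and S :: "nat \<Rightarrow> 'a::complex_hilbert_space \<Rightarrow> 'a"
    and P :: "(nat \<Rightarrow> nat) set \<Rightarrow> 'a \<Rightarrow> 'a"
    and \<Omega> :: "(nat \<Rightarrow> nat) set"
  assumes "N \<ge> 2"
    and "cuntz_rep N UNIV S"
    and "associated_pvm N UNIV S P"
    and "purely_atomic_supported_on N UNIV P \<Omega>"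
    and "aperiodic_set \<Omega>"
  shows "permutative N UNIV S \<and>
    (\<exists>\<M>. orthogonal_direct_sum UNIV \<M> \<and> (\<forall>M\<in>\<M>. permutative_injective N M S))"
proof -
  interpret aperiodic_atomic_representation N S P \<Omega>
    by unfold_locales (fact assms)+
  show ?thesis
    by (rule permutative_decomposition)
qed

end
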